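(* Suppose a weak calibration algorithm $\mathcal{A}$ satisfies the following uniform bound on its calibration rate: when run with $m$ outcomes and a set $\mathcal{W}^\varepsilon$ of triangulated test functions on $\Delta_m$ at precision $\varepsilon$, one has $C_T(X_{1:T},\mathcal{A},\mathcal{W}^\varepsilon)\le F(m,\mathcal{W}^\varepsilon,T)$ for every outcome sequence $X_{1:T}$, where $F$ does not depend on $X_{1:T}$. Let $d>2$ and $0<\varepsilon<\frac1{d^3}$, and let $U_1,U_2\in[0,1]^{d\times d}$ be the payoff matrices of a two-player game. Then, with probability greater than $1/2$, the procedure NashViaCalibration (defined in the context, run with the $d^2$-outcome space, a set $\mathcal{W}^\varepsilon$ of triangulated test functions on $\Delta_{d^2}$ at precision $\varepsilon$, $T$ rounds, and $\delta=\varepsilon^{1/3}$) returns a $\big(4F(d^2,\mathcal{W}^\varepsilon,T)+22\,d\,\varepsilon^{1/3}\big)$-Nash equilibrium of the game $(U_1,U_2)$.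
   Context: $\|\cdot\|$ denotes the $\ell_1$ norm. $\Delta_m=\{p\in\mathbb{R}^m:p_i\ge0,\sum_ip_i=1\}$. Weak calibration. With $m$ possible outcomes, each outcome $X_t\in\{0,1\}^m$ is a standard basis vector. A weak calibration algorithm (deterministic forecaster) $\mathcal{A}$ outputs $p_t=\mathcal{A}(X_1,\dots,X_{t-1})\in\Delta_m$ at each round $t$ ($p_1=\mathcal{A}(\emptyset)$). A triangulation of $\Delta_m$ is a (finite) partition into simplices any two of which intersect in a common face, a common vertex, or not at all; $V$ is its vertex set, and $V(q)$ is the set of corners of a simplex of the triangulation containing $q$. For $p\in V(q)$, $\omega_p(q)$ are the unique barycentric weights (nonnegative, summing to one) with $q=\sum_{p\in V(q)}\omega_p(q)p$; for $p\in V\setminus V(q)$, $\omega_p(q)=0$. The set $\mathcal{W}^\varepsilon=\{\omega_p\}_{p\in V}$ of triangulated test functions is at precision $\varepsilon$ if the ($\ell_1$) diameter of $V(q)$ is less than $\varepsilon$ for all $q$. The weak-calibration rate is $$C_T(X_{1:T},\mathcal{A},\mathcal{W}^\varepsilon)=\frac1T\sum_{p\in V}\Big\|\sum_{t=1}^T\omega_p(p_t)(p_t-X_t)\Big\|.$$ Games. For mixed strategies $x$ (row player) and $y$ (column player) in $\Delta_d$, $U_k(x,y)=x^\top U_k y$, the payoff of player $k\in\{1,2\}$. A pair $(x,y)$ is an $\eta$-Nash equilibrium if $U_1(x,y)\ge U_1(\tilde x,y)-\eta$ and $U_2(x,y)\ge U_2(x,\tilde y)-\eta$ for all $\tilde x,\tilde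 y\in\Delta_d$. Smooth best responses. For $q\in\Delta_d$, $\mathbf{BR}_1(q)$ is a member of $\arg\max_{x\in\Delta_d}U_1(x,q)$ and $\mathbf{BR}_2(q)$ is a member of $\arg\max_{y\in\Delta_d}U_2(q,y)$, chosen arbitrarily (but so that $\mathbf{BR}_i$ is a measurable function). For $q\in\mathbb{R}^d$, $\mathbf{BR}_i(q):=\mathbf{BR}_i(\Pi(q))$ with $\Pi(q)=\arg\min_{r\in\Delta_d}\|q-r\|_2$. For $\delta>0$, $\mathbf{BR}_{i,\delta}(q)=\mathbb{E}[\mathbf{BR}_i(q')]$, with $q'$ uniform on the cube $\{q'\in\mathbb{R}^d:\|q'-q\|_\infty\le\delta\}$. For a distribution $p$ on $[d]\times[d]$ (an element of $\Delta_{d^2}$) with marginals $[p]_1,[p]_2\in\Delta_d$ on the first and second coordinates, $\mathbf{BR}_\delta(p)=(\mathbf{BR}_{1,\delta}([p]_2),\mathbf{BR}_{2,\delta}([p]_1))$, also identified with the product distribution $\mathbf{BR}_{1,\delta}([p]_2)\times\mathbf{BR}_{2,\delta}([p]_1)$. Procedure NashViaCalibration. The outcomes are the $d^2$ pairs in $[d]\times[d]$. Set $\delta=\varepsilon^{1/3}$ and $p_1=\mathcal{A}(\emptyset)\in\Delta_{d^2}$. For $t=1,\dots,T$: sample the outcome $X_t$ (given the past) from the product distribution $\mathbf{BR}_{1,\delta}([p_t]_2)\times\mathbf{BR}_{2,\delta}([p_t]_1)$, and set $p_{t+1}=\mathcal{A}(X_1,\dots,X_t)$. Then sample $t$ uniformly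 from $\{1,\dots,T\}$, sample $p\in V(p_t)$ with probability $\omega_p(p_t)$, and return the pair $\mathbf{BR}_\delta(p)=(\mathbf{BR}_{1,\delta}([p]_2),\mathbf{BR}_{2,\delta}([p]_1))$. *)

theory Defs
  imports "HOL-Probability.Probability"
begin

section \<open>Norm and probability simplex\<close>

definition l1_norm :: "real ^ 'n \<Rightarrow> real" where
  "l1_norm x = (\<Sum>i\<in>UNIV. \<bar>x $ i\<bar>)"

text \<open>The analogue of the library's \<^const>\<open>diameter\<close> for the \<open>\<ell>\<^sub>1\<close> distance.\<close>

definition l1_diameter :: "(real ^ 'n) set \<Rightarrow> real" where
  "l1_diameter S = (if S = {} then 0 else SUP (x, y)\<in>S \<times> S. l1_norm (x - y))"

definition prob_simplex :: "(real ^ 'n) set" where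
  "prob_simplex = {p. (\<forall>i. 0 \<le> p $ i) \<and> (\<Sum>i\<in>UNIV. p $ i) = 1}"

definition simplex_pmf :: "real ^ 'n \<Rightarrow> 'n pmf" where
  "simplex_pmf p = embed_pmf (\<lambda>i. p $ i)"


section \<open>Triangulated test functions and weak calibration\<close>

text \<open>
  The type \<^typ>\<open>'m\<close> is the set of outcomes, so the number of outcomes is the cardinality of
  \<^typ>\<open>'m\<close>; the outcome \<open>i\<close> corresponds to the standard basis vector \<open>axis i 1\<close>.
  A set of triangulated test functions is represented by the triangulation
  \<open>\<T>\<close> that induces it. The library's \<^const>\<open>triangulation\<close> permits, but does not require, that
  proper faces of the simplices are themselves members of \<open>\<T>\<close>.
\<close>

definition triangulates_simplex :: "(real ^ 'm) set set \<Rightarrow> bool" where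
  "triangulates_simplex \<T> \<longleftrightarrow> triangulation \<T> \<and> \<Union>\<T> = prob_simplex"

definition vertices :: "(real ^ 'm) set set \<Rightarrow> (real ^ 'm) set" where
  "vertices \<T> = (\<Union>S\<in>\<T>. {v. v extreme_point_of S})"

text \<open>
  A point in a common face of several simplices has several candidates for its corner set; which
  one is selected affects neither the barycentric weights \<open>test_fun\<close> (they are supported on the
  corners of the common face) nor the condition \<open>at_precision\<close> (a point in the relative interior
  of a maximal simplex lies in no other member of \<open>\<T>\<close>).
\<close>

definition corners :: "(real ^ 'm) set set \<Rightarrow> real ^ 'm \<Rightarrow> (real ^ 'm) set" where
  "corners \<T> q = {v. v extreme_point_of (SOME S. S \<in> \<T> \<and> q \<in> S)}"

definition test_fun :: "(real ^ 'm) set set \<Rightarrow> real ^ 'm \<Rightarrow> real ^ 'm \<Rightarrow> real" where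
  "test_fun \<T> p q =
     (THE w. (\<forall>v\<in>corners \<T> q. 0 \<le> w v) \<and> (\<forall>v. v \<notin> corners \<T> q \<longrightarrow> w v = 0) \<and>
             (\<Sum>v\<in>corners \<T> q. w v) = 1 \<and> (\<Sum>v\<in>corners \<T> q. w v *\<^sub>R v) = q) p"

definition at_precision :: "real \<Rightarrow> (real ^ 'm) set set \<Rightarrow> bool" where
  "at_precision e \<T> \<longleftrightarrow>
     triangulates_simplex \<T> \<and> (\<forall>q\<in>prob_simplex. l1_diameter (corners \<T> q) < e)"

definition forecaster :: "('m list \<Rightarrow> real ^ 'm) \<Rightarrow> bool" where
  "forecaster A \<longleftrightarrow> (\<forall>xs. A xs \<in> prob_simplex)"

text \<open>
  Rounds are counted from \<open>0\<close>: in round \<open>t\<close> the forecast is \<open>A (take t xs)\<close>, and the outcome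
  then revealed is \<open>xs ! t\<close>.
\<close>

definition calibration_rate :: "'m list \<Rightarrow> ('m list \<Rightarrow> real ^ 'm) \<Rightarrow> (real ^ 'm) set set \<Rightarrow> real" where
  "calibration_rate xs A \<T> =
     1 / real (length xs) *
     (\<Sum>p\<in>vertices \<T>.
        l1_norm (\<Sum>t<length xs.
          test_fun \<T> p (A (take t xs)) *\<^sub>R (A (take t xs) - axis (xs ! t) 1)))"


section \<open>Two-player games\<close>

definition payoff :: "real ^ 'd ^ 'd \<Rightarrow> real ^ 'd \<Rightarrow> real ^ 'd \<Rightarrow> real" where
  "payoff U x y = x \<bullet> (U *v y)"

definition approx_nash ::
  "real \<Rightarrow> real ^ 'd ^ 'd \<Rightarrow> real ^ 'd ^ 'd \<Rightarrow> real ^ 'd \<Rightarrow> real ^ 'd \<Rightarrow> bool" where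
  "approx_nash \<eta> U1 U2 x y \<longleftrightarrow>
     x \<in> prob_simplex \<and> y \<in> prob_simplex \<and>
     (\<forall>x'\<in>prob_simplex. payoff U1 x y \<ge> payoff U1 x' y - \<eta>) \<and>
     (\<forall>y'\<in>prob_simplex. payoff U2 x y \<ge> payoff U2 x y' - \<eta>)"

text \<open>
  In \<open>best_response u BR\<close>, the function \<open>u\<close> takes the player's own strategy first and the
  opponent's strategy second.
\<close>

definition best_response ::
  "(real ^ 'd \<Rightarrow> real ^ 'd \<Rightarrow> real) \<Rightarrow> (real ^ 'd \<Rightarrow> real ^ 'd) \<Rightarrow> bool" where
  "best_response u BR \<longleftrightarrow>
     (\<forall>q\<in>prob_simplex. is_arg_max (\<lambda>x. u x q) (\<lambda>x. x \<in> prob_simplex) (BR q)) \<and>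
     BR \<in> borel_measurable (restrict_space borel prob_simplex)"

definition smooth_br :: "real \<Rightarrow> (real ^ 'd \<Rightarrow> real ^ 'd) \<Rightarrow> real ^ 'd \<Rightarrow> real ^ 'd" where
  "smooth_br \<delta> BR q =
     (LINT q'|uniform_measure lborel {q'. infnorm (q' - q) \<le> \<delta>}. BR (closest_point prob_simplex q'))"

definition marginal1 :: "real ^ ('d \<times> 'd) \<Rightarrow> real ^ 'd" where
  "marginal1 p = (\<chi> i. \<Sum>j\<in>UNIV. p $ (i, j))"

definition marginal2 :: "real ^ ('d \<times> 'd) \<Rightarrow> real ^ 'd" where
  "marginal2 p = (\<chi> j. \<Sum>i\<in>UNIV. p $ (i, j))"

definition smooth_br_pair ::
  "real \<Rightarrow> (real ^ 'd \<Rightarrow> real ^ 'd) \<Rightarrow> (real ^ 'd \<Rightarrow> real ^ 'd) \<Rightarrow>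
   real ^ ('d \<times> 'd) \<Rightarrow> (real ^ 'd) \<times> (real ^ 'd)" where
  "smooth_br_pair \<delta> BR1 BR2 p = (smooth_br \<delta> BR1 (marginal2 p), smooth_br \<delta> BR2 (marginal1 p))"


section \<open>The procedure NashViaCalibration\<close>

primrec play ::
  "(('d \<times> 'd) list \<Rightarrow> real ^ ('d \<times> 'd)) \<Rightarrow> real \<Rightarrow>
   (real ^ 'd \<Rightarrow> real ^ 'd) \<Rightarrow> (real ^ 'd \<Rightarrow> real ^ 'd) \<Rightarrow> nat \<Rightarrow> ('d \<times> 'd) list pmf" where
  "play A \<delta> BR1 BR2 0 = return_pmf []"
| "play A \<delta> BR1 BR2 (Suc n) = do {
     xs \<leftarrow> play A \<delta> BR1 BR2 n;
     let (x, y) = smooth_br_pair \<delta> BR1 BR2 (A xs);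
     X \<leftarrow> pair_pmf (simplex_pmf x) (simplex_pmf y);
     return_pmf (xs @ [X])
   }"

definition nash_via_calibration ::
  "(('d \<times> 'd) list \<Rightarrow> real ^ ('d \<times> 'd)) \<Rightarrow> (real ^ ('d \<times> 'd)) set set \<Rightarrow> nat \<Rightarrow> real \<Rightarrow>
   (real ^ 'd \<Rightarrow> real ^ 'd) \<Rightarrow> (real ^ 'd \<Rightarrow> real ^ 'd) \<Rightarrow> ((real ^ 'd) \<times> (real ^ 'd)) pmf" where
  "nash_via_calibration A \<T> T \<delta> BR1 BR2 = do {
     xs \<leftarrow> play A \<delta> BR1 BR2 T;
     t \<leftarrow> pmf_of_set {..<T};
     p \<leftarrow> embed_pmf (\<lambda>p. test_fun \<T> p (A (take t xs)));
     return_pmf (smooth_br_pair \<delta> BR1 BR2 p)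
   }"

end

(* Write f p for the product of the smoothed best responses to the marginals of p. If a vertex p
   satisfies |p - f p| <= c, then f p is a (c + d \<delta>)-Nash equilibrium: averaging best responses over
   a cube of radius \<delta> costs at most d \<delta>, and replacing the marginals of p by those of f p costs c.
   The returned vertex p has expected error E |p - f p| <= F + \<epsilon> + 2 \<epsilon> / \<delta>: given the past, X_t has mean
   f p_t, so the error summed over the vertices is bounded by the expected calibration rate (the norm
   of an expectation is at most the expectation of the norm), up to moving from p_t to the vertex p,
   where f is Lipschitz with constant 2 / \<delta>. Markov's inequality at 4 F + 21 d \<delta> gives the
   claim with probability greater than 1/2. *)

theory Submission
  imports Defs
begin

section \<open>The \<open>\<ell>\<^sub>1\<close> norm, the simplex and payoffs\<close>

lemma l1_norm_nonneg [simp]: "0 \<le> l1_norm x"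
  by (simp add: l1_norm_def sum_nonneg)

lemma l1_norm_zero [simp]: "l1_norm 0 = 0"
  by (simp add: l1_norm_def)

lemma l1_norm_triangle: "l1_norm (x + y) \<le> l1_norm x + l1_norm y"
  unfolding l1_norm_def sum.distrib [symmetric] by (intro sum_mono) (simp add: abs_triangle_ineq)

lemma l1_norm_scaleR [simp]: "l1_norm (c *\<^sub>R x) = \<bar>c\<bar> * l1_norm x"
  by (simp add: l1_norm_def sum_distrib_left abs_mult)

lemma l1_norm_minus_commute: "l1_norm (x - y) = l1_norm (y - x)"
  by (simp add: l1_norm_def abs_minus_commute)

lemma l1_norm_sum: "l1_norm (sum f A) \<le> (\<Sum>a\<in>A. l1_norm (f a))"
proof (induction A rule: infinite_finite_induct)
  case (insert a A)
  then show ?case using l1_norm_triangle [of "f a" "sum f A"] by simp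
qed simp_all

lemma component_le_l1_norm: "\<bar>x $ i\<bar> \<le> l1_norm x"
  unfolding l1_norm_def by (rule member_le_sum) auto

text \<open>Cauchy-Schwarz against the sign vector of \<open>x\<close>, whose entries lie in {-1, 0,
  1}.\<close>

lemma l1_norm_le_norm:
  fixes x :: "real ^ 'n"
  shows "l1_norm x \<le> sqrt (real CARD('n)) * norm x"
proof -
  define s :: "real ^ 'n" where "s = (\<chi> i. sgn (x $ i))"
  have "l1_norm x = s \<bullet> x"
    by (simp add: l1_norm_def s_def inner_vec_def abs_sgn mult.commute)
  also have "\<dots> \<le> norm s * norm x"
    by (rule norm_cauchy_schwarz)
  also have "norm s \<le> sqrt (real CARD('n)) * 1"
  proof -
    have "norm s = sqrt (\<Sum>i\<in>UNIV. (s $ i)\<^sup>2)"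
      by (simp add: norm_vec_def L2_set_def)
    also have "\<dots> \<le> sqrt (\<Sum>i\<in>(UNIV::'n set). 1)"
      by (intro real_sqrt_le_mono sum_mono) (auto simp: s_def sgn_if)
    finally show ?thesis by simp
  qed
  finally show ?thesis by (simp add: mult_right_mono)
qed

section \<open>The probability simplex\<close>

lemma prob_simplexD:
  assumes "p \<in> prob_simplex"
  shows "0 \<le> p $ i" "(\<Sum>i\<in>UNIV. p $ i) = 1" "p $ i \<le> 1"
proof -
  show *: "0 \<le> p $ i" "(\<Sum>i\<in>UNIV. p $ i) = 1" for i
    using assms by (auto simp: prob_simplex_def)
  show "p $ i \<le> 1"
    using member_le_sum [of i UNIV "\<lambda>i. p $ i"] * by simp
qed

lemma l1_norm_prob_simplex: "p \<in> prob_simplex \<Longrightarrow> l1_norm p = 1"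
  by (simp add: l1_norm_def prob_simplexD)

lemma axis_in_prob_simplex: "axis i 1 \<in> prob_simplex"
  by (simp add: prob_simplex_def axis_def)

lemma prob_simplex_nonempty: "prob_simplex \<noteq> {}"
  using axis_in_prob_simplex by blast

lemma closed_prob_simplex: "closed (prob_simplex :: (real ^ 'n) set)"
  unfolding prob_simplex_def Collect_conj_eq Collect_all_eq
  by (intro closed_Int closed_INT ballI closed_Collect_le closed_Collect_eq continuous_intros)

lemma convex_prob_simplex: "convex (prob_simplex :: (real ^ 'n) set)"
proof (rule convexI)
  fix x y :: "real ^ 'n" and u v :: real
  assume "x \<in> prob_simplex" "y \<in> prob_simplex" "0 \<le> u" "0 \<le> v" "u + v = 1"
  then show "u *\<^sub>R x + v *\<^sub>R y \<in> prob_simplex"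
    by (auto simp: prob_simplex_def sum.distrib sum_distrib_left [symmetric])
qed

lemma closest_point_prob_simplex: "closest_point prob_simplex x \<in> prob_simplex"
  using closed_prob_simplex prob_simplex_nonempty by (rule closest_point_in_set)

text \<open>\<open>embed_pmf\<close> returns the given weights once they are nonnegative and sum to
  1, which is membership in the simplex.\<close>

lemma pmf_simplex_pmf:
  assumes "p \<in> prob_simplex"
  shows "pmf (simplex_pmf p) i = p $ i"
  unfolding simplex_pmf_def
proof (rule pmf_embed_pmf)
  show "(\<integral>\<^sup>+x. ennreal (p $ x) \<partial>count_space UNIV) = 1"
    using prob_simplexD [OF assms] by (simp add: nn_integral_count_space_finite sum_ennreal)
qed (use prob_simplexD [OF assms] in auto)

section \<open>Marginals and product distributions\<close>

lemma marginal1_in_prob_simplex: "p \<in> prob_simplex \<Longrightarrow> marginal1 p \<in> prob_simplex"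
  unfolding prob_simplex_def marginal1_def
  by (auto simp: sum.cartesian_product UNIV_Times_UNIV intro!: sum_nonneg)

lemma marginal2_in_prob_simplex: "p \<in> prob_simplex \<Longrightarrow> marginal2 p \<in> prob_simplex"
  using sum.swap [of "\<lambda>i j. p $ (i, j)" UNIV UNIV]
  unfolding prob_simplex_def marginal2_def
  by (auto simp: sum.cartesian_product UNIV_Times_UNIV intro!: sum_nonneg)

text \<open>The triangle inequality within each row. A joint distribution close to a product
  therefore has marginals close to its factors.\<close>

lemma l1_norm_marginal1: "l1_norm (marginal1 p - marginal1 q) \<le> l1_norm (p - q)"
proof -
  have "l1_norm (marginal1 p - marginal1 q) = (\<Sum>i\<in>UNIV. \<bar>\<Sum>j\<in>UNIV. (p - q) $ (i, j)\<bar>)"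
    by (simp add: l1_norm_def marginal1_def sum_subtractf)
  also have "\<dots> \<le> (\<Sum>i\<in>UNIV. \<Sum>j\<in>UNIV. \<bar>(p - q) $ (i, j)\<bar>)"
    by (intro sum_mono sum_abs)
  also have "\<dots> = l1_norm (p - q)"
    unfolding l1_norm_def by (simp add: sum.cartesian_product flip: UNIV_Times_UNIV)
  finally show ?thesis .
qed

lemma l1_norm_marginal2: "l1_norm (marginal2 p - marginal2 q) \<le> l1_norm (p - q)"
proof -
  have "l1_norm (marginal2 p - marginal2 q) = (\<Sum>j\<in>UNIV. \<bar>\<Sum>i\<in>UNIV. (p - q) $ (i, j)\<bar>)"
    by (simp add: l1_norm_def marginal2_def sum_subtractf)
  also have "\<dots> \<le> (\<Sum>j\<in>UNIV. \<Sum>i\<in>UNIV. \<bar>(p - q) $ (i, j)\<bar>)"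
    by (intro sum_mono sum_abs)
  also have "\<dots> = (\<Sum>i\<in>UNIV. \<Sum>j\<in>UNIV. \<bar>(p - q) $ (i, j)\<bar>)"
    by (rule sum.swap)
  also have "\<dots> = l1_norm (p - q)"
    unfolding l1_norm_def by (simp add: sum.cartesian_product flip: UNIV_Times_UNIV)
  finally show ?thesis .
qed

text \<open>For \<open>x\<close> and \<open>y\<close> in the simplex this is the product
  distribution. It is a vector rather than a pmf because the factors are also differences of
  strategies, with entries of either sign.\<close>

definition product_vec :: "real ^ 'd \<Rightarrow> real ^ 'e \<Rightarrow> real ^ ('d \<times> 'e)" where
  "product_vec x y = (\<chi> k. x $ fst k * y $ snd k)"

lemma marginal1_product_vec: "y \<in> prob_simplex \<Longrightarrow> marginal1 (product_vec x y) = x"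
  by (simp add: marginal1_def product_vec_def vec_eq_iff prob_simplexD flip: sum_distrib_left)

lemma marginal2_product_vec: "x \<in> prob_simplex \<Longrightarrow> marginal2 (product_vec x y) = y"
  by (simp add: marginal2_def product_vec_def vec_eq_iff prob_simplexD flip: sum_distrib_right)

lemma l1_norm_product_vec: "l1_norm (product_vec x y) = l1_norm x * l1_norm y"
  unfolding l1_norm_def product_vec_def sum_product
  by (simp add: sum.cartesian_product abs_mult case_prod_beta flip: UNIV_Times_UNIV)

lemma product_vec_diff_left: "product_vec (x - x') y = product_vec x y - product_vec x' y"
  by (simp add: product_vec_def vec_eq_iff algebra_simps)

lemma product_vec_diff_right: "product_vec x (y - y') = product_vec x y - product_vec x y'"
  by (simp add: product_vec_def vec_eq_iff algebra_simps)

text \<open>One factor is changed at a time. The norm is multiplicative on products, and the factors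
  held fixed, \<open>y\<close> and then \<open>x'\<close>, have norm 1.\<close>

lemma l1_norm_product_vec_diff:
  assumes "x' \<in> prob_simplex" "y \<in> prob_simplex"
  shows "l1_norm (product_vec x y - product_vec x' y') \<le> l1_norm (x - x') + l1_norm (y - y')"
proof -
  have "product_vec x y - product_vec x' y' = product_vec (x - x') y + product_vec x' (y - y')"
    by (simp add: product_vec_diff_left product_vec_diff_right)
  then show ?thesis
    using l1_norm_triangle [of "product_vec (x - x') y" "product_vec x' (y - y')"] assms
    by (simp add: l1_norm_product_vec l1_norm_prob_simplex)
qed

section \<open>Payoffs as linear forms in the opponent's strategy\<close>

lemma payoff_eq_sum: "payoff U x y = (\<Sum>j\<in>UNIV. (\<Sum>i\<in>UNIV. x $ i * U $ i $ j) * y $ j)"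
  unfolding payoff_def inner_vec_def matrix_vector_mult_def
  by (simp add: sum_distrib_left sum_distrib_right mult.assoc)
     (rule sum.swap)

lemma payoff_diff_right: "payoff U x (y - z) = payoff U x y - payoff U x z"
  by (simp add: payoff_def matrix_vector_mult_diff_distrib inner_diff_right)

text \<open>This turns the column player into a row player, so that results on best responses are
  proved for one player and apply to both.\<close>

lemma payoff_transpose: "payoff (transpose U) x y = payoff U y x"
  unfolding payoff_def by (metis dot_lmul_matrix inner_commute transpose_matrix_vector vector_transpose_matrix)

text \<open>The gain from deviating is linear in the opponent's strategy, and its coefficients are
  differences of two numbers in [0,1]. Bounding the gain as a whole gives the constant 1, where
  bounding its two payoffs separately would give 2.\<close>

lemma payoff_gain_lipschitz:
  assumes U: "\<And>i j. 0 \<le> U $ i $ j \<and> U $ i $ j \<le> 1"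
    and x: "x \<in> prob_simplex" and x': "x' \<in> prob_simplex"
  shows "(payoff U x' y - payoff U x y) - (payoff U x' z - payoff U x z) \<le> l1_norm (y - z)"
proof -
  \<comment> \<open>The expected payoff of \<open>x\<close> against the pure strategy
    \<open>j\<close>, a convex combination of matrix entries.\<close>
  define c where "c x j = (\<Sum>i\<in>UNIV. x $ i * U $ i $ j)" for x and j
  have c: "0 \<le> c x j" "c x j \<le> 1" if "x \<in> prob_simplex" for x j
  proof -
    show "0 \<le> c x j"
      unfolding c_def by (intro sum_nonneg mult_nonneg_nonneg) (use that U in \<open>auto simp: prob_simplexD\<close>)
    have "c x j \<le> (\<Sum>i\<in>UNIV. x $ i)"
      unfolding c_def using that U by (intro sum_mono) (auto simp: prob_simplexD mult_left_le)
    then show "c x j \<le> 1" using that by (simp add: prob_simplexD)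
  qed
  have "(payoff U x' y - payoff U x y) - (payoff U x' z - payoff U x z) = payoff U x' (y - z) - payoff U x (y - z)"
    by (simp add: payoff_diff_right)
  also have "\<dots> = (\<Sum>j\<in>UNIV. (c x' j - c x j) * (y - z) $ j)"
    by (simp add: payoff_eq_sum c_def sum_subtractf left_diff_distrib)
  also have "\<dots> \<le> (\<Sum>j\<in>UNIV. 1 * \<bar>(y - z) $ j\<bar>)"
  proof (rule sum_mono)
    fix j
    have "\<bar>c x' j - c x j\<bar> \<le> 1" using c [OF x, of j] c [OF x', of j] by linarith
    then have "\<bar>(c x' j - c x j) * (y - z) $ j\<bar> \<le> 1 * \<bar>(y - z) $ j\<bar>"
      unfolding abs_mult by (rule mult_right_mono) simp
    then show "(c x' j - c x j) * (y - z) $ j \<le> 1 * \<bar>(y - z) $ j\<bar>" by linarith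
  qed
  finally show ?thesis by (simp add: l1_norm_def)
qed

section \<open>Smoothed best responses\<close>

text \<open>The Weierstrass product inequality, by induction on the index set. It turns the volume
  of an overlap of cubes into an l1 distance of their centres.\<close>

lemma prod_one_minus_ge:
  fixes a :: "'i \<Rightarrow> real"
  assumes "\<And>i. i \<in> I \<Longrightarrow> 0 \<le> a i" "\<And>i. i \<in> I \<Longrightarrow> a i \<le> 1"
  shows "1 - sum a I \<le> (\<Prod>i\<in>I. 1 - a i)"
  using assms
proof (induction I rule: infinite_finite_induct)
  case (insert i I)
  have "(\<Prod>i\<in>I. 1 - a i) \<le> 1"
    using insert.prems by (intro prod_le_1) auto
  then have "a i * (\<Prod>i\<in>I. 1 - a i) \<le> a i * 1"
    using insert.prems by (intro mult_left_mono) auto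
  then show ?case
    using insert by (simp add: algebra_simps)
qed simp_all

text \<open>The closed sup-norm ball, written as a box so that volumes and intersections of boxes
  apply.\<close>

definition cube :: "real \<Rightarrow> real ^ 'n \<Rightarrow> (real ^ 'n) set" where
  "cube \<delta> q = cbox (\<chi> i. q $ i - \<delta>) (\<chi> i. q $ i + \<delta>)"

lemma mem_cube: "x \<in> cube \<delta> q \<longleftrightarrow> (\<forall>i. \<bar>x $ i - q $ i\<bar> \<le> \<delta>)"
  by (auto simp: cube_def mem_box_cart abs_le_iff algebra_simps)

lemma infnorm_ball_eq_cube: "{x. infnorm (x - q) \<le> \<delta>} = cube \<delta> q"
proof -
  have "infnorm x \<le> \<delta> \<longleftrightarrow> (\<forall>i. \<bar>x $ i\<bar> \<le> \<delta>)" for x :: "real ^ 'a"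
  proof
    assume "infnorm x \<le> \<delta>"
    then show "\<forall>i. \<bar>x $ i\<bar> \<le> \<delta>"
      using component_le_infnorm_cart order_trans by blast
  next
    assume "\<forall>i. \<bar>x $ i\<bar> \<le> \<delta>"
    then show "infnorm x \<le> \<delta>"
      unfolding infnorm_cart by (intro cSup_least) auto
  qed
  then show ?thesis
    by (simp add: mem_cube set_eq_iff)
qed

lemma measure_cube:
  fixes q :: "real ^ 'n"
  assumes "0 < \<delta>"
  shows "measure lborel (cube \<delta> q) = (2 * \<delta>) ^ CARD('n)"
proof -
  have "cube \<delta> q \<noteq> {}"
    using assms mem_cube [of q \<delta> q] by auto
  then show ?thesis
    by (simp add: cube_def content_cbox_if_cart)
qed

text \<open>The overlap is a box with sides
  \<open>2 * \<delta> - \<bar>q $ i - q' $ i\<bar>\<close>; factor \<open>2 * \<delta>\<close> out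
  of each side and apply \<open>prod_one_minus_ge\<close>. If some coordinates differ by more than
  \<open>2 * \<delta>\<close>, the lower bound is not positive.\<close>

lemma measure_cube_Int:
  fixes q q' :: "real ^ 'n"
  assumes \<delta>: "0 < \<delta>"
  shows "(2 * \<delta>) ^ CARD('n) * (1 - l1_norm (q - q') / (2 * \<delta>)) \<le> measure lborel (cube \<delta> q \<inter> cube \<delta> q')"
proof (cases "\<forall>i. \<bar>q $ i - q' $ i\<bar> \<le> 2 * \<delta>")
  case True
  have eq: "cube \<delta> q \<inter> cube \<delta> q' =
      cbox (\<chi> i. max (q $ i - \<delta>) (q' $ i - \<delta>)) (\<chi> i. min (q $ i + \<delta>) (q' $ i + \<delta>))" (is "_ = ?C")
    by (simp add: cube_def Int_interval_cart interval_cbox_cart)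
  have "(\<chi> i. max (q $ i - \<delta>) (q' $ i - \<delta>)) \<in> ?C"
    using True \<delta> by (auto simp: mem_box_cart max_def min_def abs_le_iff algebra_simps)
  then have ne: "?C \<noteq> {}" by blast
  have "(2 * \<delta>) ^ CARD('n) * (1 - l1_norm (q - q') / (2 * \<delta>)) =
      (2 * \<delta>) ^ CARD('n) * (1 - (\<Sum>i\<in>UNIV. \<bar>q $ i - q' $ i\<bar> / (2 * \<delta>)))"
    by (simp add: l1_norm_def sum_divide_distrib)
  also have "\<dots> \<le> (2 * \<delta>) ^ CARD('n) * (\<Prod>i\<in>UNIV. 1 - \<bar>q $ i - q' $ i\<bar> / (2 * \<delta>))"
    using True \<delta> by (intro mult_left_mono prod_one_minus_ge) (auto simp: field_simps)
  also have "\<dots> = (\<Prod>i\<in>UNIV. (2 * \<delta>) * (1 - \<bar>q $ i - q' $ i\<bar> / (2 * \<delta>)))"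
    by (simp add: prod.distrib power_mult_distrib)
  also have "\<dots> = (\<Prod>i\<in>UNIV. min (q $ i + \<delta>) (q' $ i + \<delta>) - max (q $ i - \<delta>) (q' $ i - \<delta>))"
    using \<delta> by (intro prod.cong) (auto simp: field_simps min_def max_def)
  also have "\<dots> = measure lborel (cube \<delta> q \<inter> cube \<delta> q')"
    unfolding eq using ne by (simp add: content_cbox_if_cart)
  finally show ?thesis .
next
  case False
  then obtain i where "2 * \<delta> < \<bar>q $ i - q' $ i\<bar>" by (auto simp: not_le)
  also have "\<dots> \<le> l1_norm (q - q')"
    using component_le_l1_norm [of "q - q'" i] by simp
  finally have "1 - l1_norm (q - q') / (2 * \<delta>) \<le> 0"
    using \<delta> by (simp add: field_simps)
  then have "(2 * \<delta>) ^ CARD('n) * (1 - l1_norm (q - q') / (2 * \<delta>)) \<le> 0"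
    using \<delta> by (intro mult_nonneg_nonpos) auto
  then show ?thesis using measure_nonneg order_trans by blast
qed

lemma emeasure_cube:
  fixes q :: "real ^ 'n"
  assumes "0 < \<delta>"
  shows "emeasure lborel (cube \<delta> q) = ennreal ((2 * \<delta>) ^ CARD('n))"
  unfolding measure_cube [OF assms, symmetric, of q]
  by (rule emeasure_eq_ennreal_measure) (simp add: cube_def emeasure_lborel_cbox_eq)

lemma cube_sets [measurable, simp]: "cube \<delta> q \<in> sets borel"
  by (simp add: cube_def)

lemma prob_space_uniform_cube:
  assumes "0 < \<delta>"
  shows "prob_space (uniform_measure lborel (cube \<delta> q))"
  by (rule prob_space_uniform_measure) (use assms in \<open>simp_all add: emeasure_cube\<close>)

text \<open>Averages over cubes with different centres become integrals against one measure, so that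
  they can be subtracted under the integral.\<close>

lemma integral_uniform_cube:
  fixes q :: "real ^ 'n" and g :: "real ^ 'n \<Rightarrow> real ^ 'm"
  assumes \<delta>: "0 < \<delta>" and g: "g \<in> borel_measurable borel"
  shows "(LINT x|uniform_measure lborel (cube \<delta> q). g x) =
    (LINT x|lborel. (indicator (cube \<delta> q) x / (2 * \<delta>) ^ CARD('n)) *\<^sub>R g x)"
proof -
  have "uniform_measure lborel (cube \<delta> q) =
      density lborel (\<lambda>x. ennreal (indicator (cube \<delta> q) x / (2 * \<delta>) ^ CARD('n)))"
    unfolding uniform_measure_def using \<delta>
    by (intro arg_cong [where f = "density lborel"] ext)
       (simp add: emeasure_cube divide_ennreal flip: ennreal_indicator)
  then show ?thesis
    using \<delta> g by (simp add: integral_density)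
qed

section \<open>Range and Lipschitz continuity of the smoothed best response\<close>

context
  fixes u :: "real ^ 'd \<Rightarrow> real ^ 'd \<Rightarrow> real" and BR :: "real ^ 'd \<Rightarrow> real ^ 'd" and \<delta> :: real
  assumes BR: "best_response u BR" and \<delta>: "0 < \<delta>"
begin

private abbreviation "br_proj x \<equiv> BR (closest_point prob_simplex x)"

lemma br_proj_in_prob_simplex: "br_proj x \<in> prob_simplex"
  using BR closest_point_prob_simplex unfolding best_response_def is_arg_max_def by blast

lemma br_proj_optimal:
  "x' \<in> prob_simplex \<Longrightarrow> u x' (closest_point prob_simplex x) \<le> u (br_proj x) (closest_point prob_simplex x)"
  using BR closest_point_prob_simplex [of x] unfolding best_response_def is_arg_max_def
  by (metis not_le_imp_less)

text \<open>Projection onto a closed convex set is continuous, and \<open>BR\<close> is measurable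
  on the simplex, where the projection takes its values.\<close>

lemma br_proj_measurable [measurable]: "br_proj \<in> borel_measurable borel"
proof -
  have "closest_point prob_simplex \<in> borel \<rightarrow>\<^sub>M restrict_space borel prob_simplex"
    using closest_point_prob_simplex
    by (intro measurable_restrict_space2 borel_measurable_continuous_onI continuous_on_closest_point
        convex_prob_simplex closed_prob_simplex prob_simplex_nonempty) auto
  moreover have "BR \<in> borel_measurable (restrict_space borel prob_simplex)"
    using BR by (simp add: best_response_def)
  ultimately show ?thesis by (rule measurable_compose)
qed

lemma br_proj_norm_le: "norm (br_proj x) \<le> 1"
  using norm_le_l1_cart [of "br_proj x"] l1_norm_prob_simplex [OF br_proj_in_prob_simplex [of x]]
  by (simp add: l1_norm_def)

lemma br_proj_integrable: "integrable (uniform_measure lborel (cube \<delta> q)) br_proj"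
proof -
  interpret prob_space "uniform_measure lborel (cube \<delta> q)"
    using \<delta> by (rule prob_space_uniform_cube)
  show ?thesis
    using br_proj_norm_le by (intro integrable_const_bound [where B = 1]) auto
qed

lemma smooth_br_eq: "smooth_br \<delta> BR q = (LINT x|uniform_measure lborel (cube \<delta> q). br_proj x)"
  by (simp add: smooth_br_def infnorm_ball_eq_cube)

lemma smooth_br_in_prob_simplex: "smooth_br \<delta> BR q \<in> prob_simplex"
proof -
  interpret prob_space "uniform_measure lborel (cube \<delta> q)"
    using \<delta> by (rule prob_space_uniform_cube)
  have *: "smooth_br \<delta> BR q $ i = (LINT x|uniform_measure lborel (cube \<delta> q). br_proj x $ i)" for i
    unfolding smooth_br_eq
    by (rule integral_bounded_linear [OF bounded_linear_vec_nth br_proj_integrable, symmetric])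
  have nonneg: "0 \<le> smooth_br \<delta> BR q $ i" for i
    unfolding * by (simp add: prob_simplexD [OF br_proj_in_prob_simplex])
  have int: "integrable (uniform_measure lborel (cube \<delta> q)) (\<lambda>x. br_proj x $ i)" for i
    by (rule integrable_bounded_linear [OF bounded_linear_vec_nth br_proj_integrable])
  have "(\<Sum>i\<in>UNIV. smooth_br \<delta> BR q $ i) = (LINT x|uniform_measure lborel (cube \<delta> q). (\<Sum>i\<in>UNIV. br_proj x $ i))"
    unfolding * by (rule Bochner_Integration.integral_sum [symmetric]) (rule int)
  also have "\<dots> = 1"
    using prob_space by (simp add: prob_simplexD [OF br_proj_in_prob_simplex])
  finally show ?thesis
    using nonneg by (simp add: prob_simplex_def)
qed

text \<open>Averaging probability vectors against two densities gives results no further apart than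
  the densities in L1. For two uniform cubes that distance is 2 minus twice the overlapping
  fraction, which \<open>measure_cube_Int\<close> bounds.\<close>

lemma smooth_br_lipschitz: "l1_norm (smooth_br \<delta> BR q - smooth_br \<delta> BR q') \<le> l1_norm (q - q') / \<delta>"
proof -
  define V where "V = (2 * \<delta>) ^ CARD('d)"
  have V: "0 < V" using \<delta> by (simp add: V_def)
  define I :: "real ^ 'd \<Rightarrow> real ^ 'd \<Rightarrow> real" where "I q = indicator (cube \<delta> q)" for q
  have I_int: "integrable lborel (I q)" for q
    unfolding I_def using \<delta> by (intro integrable_real_indicator) (simp_all add: emeasure_cube)
  have I_meas [measurable]: "I q \<in> borel_measurable borel" for q
    unfolding I_def by simp
  have br: "0 \<le> br_proj x $ i" "br_proj x $ i \<le> 1" "(\<Sum>i\<in>UNIV. br_proj x $ i) = 1" for x i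
    using prob_simplexD [OF br_proj_in_prob_simplex] by auto
  have g_meas [measurable]: "(\<lambda>x. br_proj x $ i) \<in> borel_measurable borel" for i
    using measurable_compose [OF br_proj_measurable borel_measurable_continuous_onI [OF continuous_on_component [OF continuous_on_id]]] by simp
  have Ig_int: "integrable lborel (\<lambda>x. h x * br_proj x $ i)" if "integrable lborel h" for h i
    by (rule Bochner_Integration.integrable_bound [OF that])
       (use that br in \<open>auto simp: abs_mult intro!: AE_I2 mult_left_le\<close>)
  have vint: "integrable lborel (\<lambda>x. (I q x / V) *\<^sub>R br_proj x)" for q
    by (rule Bochner_Integration.integrable_bound [where f = "\<lambda>x. I q x / V"])
       (use I_int V br_proj_norm_le in \<open>auto simp: I_def intro!: AE_I2 mult_left_le divide_right_mono\<close>)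
  have comp: "smooth_br \<delta> BR q $ i = (LINT x|lborel. (I q x / V) * br_proj x $ i)" for q i
    unfolding smooth_br_eq integral_uniform_cube [OF \<delta> br_proj_measurable] V_def [symmetric] I_def [symmetric]
    by (subst integral_bounded_linear [OF bounded_linear_vec_nth vint, symmetric]) simp
  \<comment> \<open>The pointwise distance of the two uniform densities.\<close>
  define D where "D x = \<bar>I q x - I q' x\<bar> / V" for x
  have D_int: "integrable lborel D"
    unfolding D_def using I_int by (intro integrable_divide integrable_abs Bochner_Integration.integrable_diff) auto
  have "\<bar>smooth_br \<delta> BR q $ i - smooth_br \<delta> BR q' $ i\<bar> \<le> (LINT x|lborel. D x * br_proj x $ i)" for i
  proof -
    have "smooth_br \<delta> BR q $ i - smooth_br \<delta> BR q' $ i =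
        (LINT x|lborel. (I q x / V) * br_proj x $ i - (I q' x / V) * br_proj x $ i)"
      unfolding comp by (subst Bochner_Integration.integral_diff) (auto intro!: Ig_int integrable_divide I_int)
    also have "\<bar>\<dots>\<bar> \<le> (LINT x|lborel. \<bar>(I q x / V) * br_proj x $ i - (I q' x / V) * br_proj x $ i\<bar>)"
      by (rule integral_abs_bound)
    also have "\<dots> = (LINT x|lborel. D x * br_proj x $ i)"
      using V br by (intro Bochner_Integration.integral_cong)
        (auto simp: D_def abs_mult simp flip: left_diff_distrib diff_divide_distrib)
    finally show ?thesis .
  qed
  then have "l1_norm (smooth_br \<delta> BR q - smooth_br \<delta> BR q') \<le> (\<Sum>i\<in>UNIV. (LINT x|lborel. D x * br_proj x $ i))"
    unfolding l1_norm_def by (intro sum_mono) simp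
  also have "\<dots> = (LINT x|lborel. (\<Sum>i\<in>UNIV. D x * br_proj x $ i))"
    by (rule Bochner_Integration.integral_sum [symmetric]) (intro Ig_int D_int)
  \<comment> \<open>The coordinates of a best response sum to 1, so the strategy disappears from the
    bound.\<close>
  also have "\<dots> = (LINT x|lborel. D x)"
    by (simp add: br flip: sum_distrib_left)
  \<comment> \<open>The indicator of a symmetric difference, by inclusion and exclusion.\<close>
  also have "\<dots> = (LINT x|lborel. (I q x + I q' x - 2 * indicator (cube \<delta> q \<inter> cube \<delta> q') x) / V)"
    by (intro Bochner_Integration.integral_cong) (auto simp: D_def I_def indicator_def)
  also have "\<dots> = (V + V - 2 * measure lborel (cube \<delta> q \<inter> cube \<delta> q')) / V"
  proof -
    have "emeasure lborel (cube \<delta> q \<inter> cube \<delta> q') \<le> emeasure lborel (cube \<delta> q)"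
      by (intro emeasure_mono) auto
    also have "\<dots> < \<infinity>" using \<delta> by (simp add: emeasure_cube)
    finally have "integrable lborel (indicator (cube \<delta> q \<inter> cube \<delta> q') :: _ \<Rightarrow> real)"
      by (intro integrable_real_indicator) auto
    then show ?thesis
      using I_int [of q] I_int [of q'] \<delta> by (simp add: I_def measure_cube V_def)
  qed
  also have "\<dots> \<le> (V + V - 2 * (V * (1 - l1_norm (q - q') / (2 * \<delta>)))) / V"
    using V measure_cube_Int [OF \<delta>, of q q'] unfolding V_def by (intro divide_right_mono) auto
  also have "\<dots> = l1_norm (q - q') / \<delta>"
    using V \<delta> by (simp add: field_simps)
  finally show ?thesis .
qed

end

text \<open>Each averaged strategy is an exact best response to a projected point within l1 distance
  \<open>d * \<delta>\<close> of \<open>q\<close>, so it loses at most that much against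
  \<open>q\<close>. Payoff is linear in the own strategy, so the average loses no more.\<close>

lemma smooth_br_approx_best_response:
  fixes U :: "real ^ 'd ^ 'd"
  assumes U: "\<And>i j. 0 \<le> U $ i $ j \<and> U $ i $ j \<le> 1"
    and BR: "best_response (payoff U) BR" and \<delta>: "0 < \<delta>"
    and q: "q \<in> prob_simplex" and x': "x' \<in> prob_simplex"
  shows "payoff U x' q - real CARD('d) * \<delta> \<le> payoff U (smooth_br \<delta> BR q) q"
proof -
  let ?g = "\<lambda>x. BR (closest_point prob_simplex x)"
  let ?N = "uniform_measure lborel (cube \<delta> q)"
  interpret prob_space ?N
    using \<delta> by (rule prob_space_uniform_cube)
  have lin: "bounded_linear (\<lambda>x. payoff U x q)"
    unfolding payoff_def by (rule bounded_linear_inner_left)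
  have "payoff U x' q - real CARD('d) * \<delta> \<le> payoff U (?g x) q" if "x \<in> cube \<delta> q" for x
  proof -
    let ?r = "closest_point prob_simplex x"
    \<comment> \<open>Projection onto the simplex is nonexpansive and fixes
      \<open>q\<close>.\<close>
    have "norm (q - ?r) \<le> norm (q - x)"
      using closest_point_lipschitz [OF convex_prob_simplex closed_prob_simplex prob_simplex_nonempty, of q x]
      by (simp add: closest_point_self q dist_norm)
    moreover have "norm (q - x) \<le> sqrt (real CARD('d)) * \<delta>"
    proof -
      have "infnorm (x - q) \<le> \<delta>" using that infnorm_ball_eq_cube by blast
      then have "sqrt (real CARD('d)) * infnorm (x - q) \<le> sqrt (real CARD('d)) * \<delta>"
        by (rule mult_left_mono) simp
      then show ?thesis
        using norm_le_infnorm [of "x - q"] norm_minus_commute [of q x] unfolding DIM_cart DIM_real mult_1_right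
        by linarith
    qed
    ultimately have "norm (q - ?r) \<le> sqrt (real CARD('d)) * \<delta>" by linarith
    \<comment> \<open>One factor sqrt d came from the sup norm to the Euclidean norm; the other
      takes the Euclidean norm to l1.\<close>
    then have "sqrt (real CARD('d)) * norm (q - ?r) \<le> sqrt (real CARD('d)) * (sqrt (real CARD('d)) * \<delta>)"
      by (rule mult_left_mono) simp
    with l1_norm_le_norm [of "q - ?r"] have "l1_norm (q - ?r) \<le> real CARD('d) * \<delta>"
      by (simp flip: mult.assoc)
    moreover have "(payoff U x' q - payoff U (?g x) q) - (payoff U x' ?r - payoff U (?g x) ?r) \<le> l1_norm (q - ?r)"
      using U br_proj_in_prob_simplex [OF BR \<delta>] x' by (rule payoff_gain_lipschitz)
    moreover have "payoff U x' ?r \<le> payoff U (?g x) ?r"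
      using BR \<delta> x' by (rule br_proj_optimal)
    ultimately show ?thesis by linarith
  qed
  then have "payoff U x' q - real CARD('d) * \<delta> \<le> (LINT x|?N. payoff U (?g x) q)"
    by (intro integral_ge_const integrable_bounded_linear [OF lin] br_proj_integrable [OF BR \<delta>]
        AE_uniform_measureI) auto
  also have "\<dots> = payoff U (smooth_br \<delta> BR q) q"
    unfolding smooth_br_eq [OF BR \<delta>]
    by (rule integral_bounded_linear [OF lin br_proj_integrable [OF BR \<delta>]])
  finally show ?thesis .
qed

section \<open>Triangulated test functions\<close>

text \<open>The difference of two such weightings would be a nontrivial affine dependence of
  \<open>C\<close>.\<close>

lemma affine_independent_weights_unique:
  fixes C :: "'a::real_vector set"
  assumes C: "finite C" "\<not> affine_dependent C"
    and eq: "sum u C = sum w C" "(\<Sum>v\<in>C. u v *\<^sub>R v) = (\<Sum>v\<in>C. w v *\<^sub>R v)"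
    and v: "v \<in> C"
  shows "u v = w v"
proof (rule ccontr)
  assume "u v \<noteq> w v"
  then have "\<exists>v\<in>C. u v - w v \<noteq> 0" using v by auto
  moreover have "(\<Sum>v\<in>C. u v - w v) = 0" "(\<Sum>v\<in>C. (u v - w v) *\<^sub>R v) = 0"
    using eq by (simp_all add: sum_subtractf scaleR_diff_left)
  ultimately show False
    using C unfolding affine_dependent_explicit_finite [OF C(1)] by blast
qed

lemma triangulation_memberE:
  assumes "triangulates_simplex \<T>" "S \<in> \<T>"
  obtains C where "finite C" "\<not> affine_dependent C" "S = convex hull C"
proof -
  have "\<forall>S\<in>\<T>. \<exists>n. n simplex S"
    using assms(1) by (simp add: triangulates_simplex_def triangulation_def)
  then obtain n where "n simplex S"
    using assms(2) by (auto simp only:)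
  then obtain C where "\<not> affine_dependent C" "S = convex hull C"
    by (auto simp only: simplex_def)
  then show ?thesis
    by (intro that [of C] aff_independent_finite)
qed

text \<open>The simplices cover \<open>prob_simplex\<close>, so the choice in \<open>corners\<close>
  has a witness; the extreme points of the hull of an affinely independent set are that set
  itself.\<close>

lemma corners_simplex:
  assumes T: "triangulates_simplex \<T>" and q: "q \<in> prob_simplex"
  obtains S where "S \<in> \<T>" "corners \<T> q = {v. v extreme_point_of S}" "finite (corners \<T> q)"
    "\<not> affine_dependent (corners \<T> q)" "q \<in> convex hull (corners \<T> q)"
proof -
  define S where "S = (SOME S. S \<in> \<T> \<and> q \<in> S)"
  have "\<exists>S. S \<in> \<T> \<and> q \<in> S"
    using T q unfolding triangulates_simplex_def by blast
  then have S: "S \<in> \<T>" "q \<in> S"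
    using someI_ex [of "\<lambda>S. S \<in> \<T> \<and> q \<in> S"] by (auto simp: S_def)
  obtain C where C: "finite C" "\<not> affine_dependent C" "S = convex hull C"
    using T S(1) by (rule triangulation_memberE)
  have "{v. v extreme_point_of S} = C"
    using C by (simp add: extreme_point_of_convex_hull_affine_independent)
  moreover have "corners \<T> q = {v. v extreme_point_of S}"
    by (simp add: corners_def S_def)
  ultimately have "corners \<T> q = C" "corners \<T> q = {v. v extreme_point_of S}"
    by simp_all
  with S C show ?thesis by (intro that [of S]) simp_all
qed

lemma finite_corners: "triangulates_simplex \<T> \<Longrightarrow> q \<in> prob_simplex \<Longrightarrow> finite (corners \<T> q)"
  by (erule corners_simplex)

lemma corners_subset_vertices:
  "triangulates_simplex \<T> \<Longrightarrow> q \<in> prob_simplex \<Longrightarrow> corners \<T> q \<subseteq> vertices \<T>"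
  unfolding vertices_def by (erule corners_simplex, assumption) blast

lemma vertices_subset_prob_simplex: "triangulates_simplex \<T> \<Longrightarrow> vertices \<T> \<subseteq> prob_simplex"
  by (auto simp: vertices_def triangulates_simplex_def extreme_point_of_def)

lemma finite_vertices:
  assumes "triangulates_simplex \<T>"
  shows "finite (vertices \<T>)"
proof -
  have "finite {v. v extreme_point_of S}" if S: "S \<in> \<T>" for S
  proof -
    obtain C where "finite C" "\<not> affine_dependent C" "S = convex hull C"
      using triangulation_memberE [OF assms S] .
    then show ?thesis by (simp add: extreme_point_of_convex_hull_affine_independent)
  qed
  then show ?thesis
    using assms by (simp add: vertices_def triangulates_simplex_def triangulation_def)
qed

text \<open>The definite description in \<open>test_fun\<close> denotes: weights exist because
  \<open>q\<close> lies in the hull of its corners, and affine independence makes them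
  unique.\<close>

lemma test_fun_props:
  assumes T: "triangulates_simplex \<T>" and q: "q \<in> prob_simplex"
  shows test_fun_nonneg: "0 \<le> test_fun \<T> v q"
    and test_fun_eq_0: "v \<notin> corners \<T> q \<Longrightarrow> test_fun \<T> v q = 0"
    and sum_test_fun_corners: "(\<Sum>v\<in>corners \<T> q. test_fun \<T> v q) = 1"
    and sum_test_fun_scaleR: "(\<Sum>v\<in>corners \<T> q. test_fun \<T> v q *\<^sub>R v) = q"
proof -
  define C where "C = corners \<T> q"
  define P where "P w \<longleftrightarrow> (\<forall>v\<in>C. 0 \<le> w v) \<and> (\<forall>v. v \<notin> C \<longrightarrow> w v = 0) \<and>
    (\<Sum>v\<in>C. w v) = 1 \<and> (\<Sum>v\<in>C. w v *\<^sub>R v) = q" for w :: "real ^ 'a \<Rightarrow> real"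
  have C: "finite C" "\<not> affine_dependent C" "q \<in> convex hull C"
    unfolding C_def by (auto intro: corners_simplex [OF T q])
  obtain u where u: "\<forall>v\<in>C. 0 \<le> u v" "sum u C = 1" "(\<Sum>v\<in>C. u v *\<^sub>R v) = q"
    using C(3) unfolding convex_hull_finite [OF C(1)] by blast
  \<comment> \<open>The weights must vanish outside \<open>C\<close> to be unique as a function on
    the whole space.\<close>
  have ex: "P (\<lambda>v. if v \<in> C then u v else 0)"
    unfolding P_def using u by (auto cong: sum.cong)
  have "w = w'" if "P w" "P w'" for w w'
  proof
    fix v
    show "w v = w' v"
      using affine_independent_weights_unique [OF C(1,2), of w w' v] that unfolding P_def
      by (cases "v \<in> C") auto
  qed
  with ex have "P (THE w. P w)"
    by (metis (no_types, lifting) theI)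
  moreover have "(THE w. P w) = (\<lambda>v. test_fun \<T> v q)"
    unfolding test_fun_def P_def C_def by simp
  ultimately have "P (\<lambda>v. test_fun \<T> v q)" by simp
  then show "0 \<le> test_fun \<T> v q" "v \<notin> corners \<T> q \<Longrightarrow> test_fun \<T> v q = 0"
    "(\<Sum>v\<in>corners \<T> q. test_fun \<T> v q) = 1" "(\<Sum>v\<in>corners \<T> q. test_fun \<T> v q *\<^sub>R v) = q"
    unfolding P_def C_def by (cases "v \<in> corners \<T> q", simp_all)
qed

lemma pmf_test_fun:
  assumes T: "triangulates_simplex \<T>" and q: "q \<in> prob_simplex"
  shows "pmf (embed_pmf (\<lambda>v. test_fun \<T> v q)) v = test_fun \<T> v q"
proof (rule pmf_embed_pmf)
  have "(\<integral>\<^sup>+v. ennreal (test_fun \<T> v q) \<partial>count_space UNIV) =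
      (\<Sum>v\<in>corners \<T> q. ennreal (test_fun \<T> v q))"
    using test_fun_eq_0 [OF T q] finite_corners [OF T q] by (intro nn_integral_count_space') auto
  then show "(\<integral>\<^sup>+v. ennreal (test_fun \<T> v q) \<partial>count_space UNIV) = 1"
    by (simp add: sum_ennreal test_fun_nonneg [OF T q] sum_test_fun_corners [OF T q])
qed (rule test_fun_nonneg [OF T q])

text \<open>Finiteness of \<open>S\<close> bounds the set of distances, so the supremum is an upper
  bound of it.\<close>

lemma l1_norm_le_l1_diameter:
  assumes "finite S" "x \<in> S" "y \<in> S"
  shows "l1_norm (x - y) \<le> l1_diameter S"
proof -
  have "l1_norm (x - y) \<le> (SUP (x, y)\<in>S \<times> S. l1_norm (x - y))"
    using assms by (intro cSUP_upper2 [of _ _ "(x, y)"]) auto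
  then show ?thesis using assms by (auto simp: l1_diameter_def)
qed

text \<open>\<open>q\<close> is a convex combination of corners, each within \<open>e\<close> of
  \<open>v\<close>.\<close>

lemma l1_norm_corner_le:
  assumes e: "at_precision e \<T>" and q: "q \<in> prob_simplex" and v: "v \<in> corners \<T> q"
  shows "l1_norm (v - q) \<le> e"
proof -
  let ?w = "\<lambda>v. test_fun \<T> v q"
  have T: "triangulates_simplex \<T>" and diam: "l1_diameter (corners \<T> q) < e"
    using e q by (auto simp: at_precision_def)
  have "v - q = (\<Sum>u\<in>corners \<T> q. ?w u *\<^sub>R (v - u))"
    by (simp add: scaleR_diff_right sum_subtractf sum_test_fun_corners [OF T q] sum_test_fun_scaleR [OF T q]
        flip: scaleR_sum_left)
  also have "l1_norm \<dots> \<le> (\<Sum>u\<in>corners \<T> q. ?w u * l1_norm (v - u))"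
    by (rule order_trans [OF l1_norm_sum]) (simp add: test_fun_nonneg [OF T q])
  also have "\<dots> \<le> (\<Sum>u\<in>corners \<T> q. ?w u * e)"
    using l1_norm_le_l1_diameter [OF finite_corners [OF T q] v] diam
    by (intro sum_mono mult_left_mono test_fun_nonneg [OF T q]) fastforce
  also have "\<dots> = e"
    by (simp add: sum_test_fun_corners [OF T q] flip: sum_distrib_right)
  finally show ?thesis .
qed

section \<open>Expected calibration along the play\<close>

text \<open>Jensen's inequality for the norm; with finite support it is the triangle inequality for
  a finite sum.\<close>

lemma l1_norm_expectation_le:
  fixes f :: "'a \<Rightarrow> real ^ 'n"
  assumes "finite (set_pmf p)"
  shows "l1_norm (measure_pmf.expectation p f) \<le> measure_pmf.expectation p (\<lambda>x. l1_norm (f x))"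
proof -
  have "l1_norm (\<Sum>x\<in>set_pmf p. pmf p x *\<^sub>R f x) \<le> (\<Sum>x\<in>set_pmf p. pmf p x * l1_norm (f x))"
    by (rule order_trans [OF l1_norm_sum]) simp
  then show ?thesis
    by (simp add: integral_measure_pmf [OF assms])
qed

lemma expectation_bind_pmf_finite:
  fixes h :: "'b \<Rightarrow> 'c::{banach, second_countable_topology}"
  assumes "finite (set_pmf p)" "\<And>x. x \<in> set_pmf p \<Longrightarrow> finite (set_pmf (f x))"
  shows "measure_pmf.expectation (p \<bind> f) h =
    measure_pmf.expectation p (\<lambda>x. measure_pmf.expectation (f x) h)"
  by (simp add: pmf_expectation_bind [OF assms order_refl] integral_measure_pmf [OF assms(1)])

text \<open>The mean of a random basis vector is the vector of its probabilities.\<close>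

lemma expectation_axis_simplex_pmf:
  assumes "x \<in> prob_simplex" "y \<in> prob_simplex"
  shows "measure_pmf.expectation (pair_pmf (simplex_pmf x) (simplex_pmf y)) (\<lambda>X. axis X 1) = product_vec x y"
proof -
  have "measure_pmf.expectation (pair_pmf (simplex_pmf x) (simplex_pmf y)) (\<lambda>X. axis X 1) =
      (\<Sum>X\<in>UNIV. pmf (pair_pmf (simplex_pmf x) (simplex_pmf y)) X *\<^sub>R axis X 1)"
    by (rule integral_measure_pmf) auto
  also have "\<dots> = product_vec x y"
    by (simp add: vec_eq_iff axis_def product_vec_def pmf_pair pmf_simplex_pmf [OF assms(1)] pmf_simplex_pmf [OF assms(2)]
        split_beta sum_distrib_left if_distrib cong: if_cong)
  finally show ?thesis .
qed

section \<open>Outcomes sampled along the play\<close>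

context
  fixes A :: "('d::finite \<times> 'd) list \<Rightarrow> real ^ ('d \<times> 'd)"
    and \<delta> :: real and BR1 BR2 :: "real ^ 'd \<Rightarrow> real ^ 'd"
begin

text \<open>The conditional law of the next outcome when the current forecast is
  \<open>p\<close>.\<close>

definition outcome_pmf :: "real ^ ('d \<times> 'd) \<Rightarrow> ('d \<times> 'd) pmf" where
  "outcome_pmf p = pair_pmf
     (simplex_pmf (fst (smooth_br_pair \<delta> BR1 BR2 p)))
     (simplex_pmf (snd (smooth_br_pair \<delta> BR1 BR2 p)))"

lemma play_Suc:
  "play A \<delta> BR1 BR2 (Suc n) =
    play A \<delta> BR1 BR2 n \<bind> (\<lambda>xs. map_pmf (\<lambda>X. xs @ [X]) (outcome_pmf (A xs)))"
  by (simp add: outcome_pmf_def map_pmf_def split_beta)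

lemma length_play: "xs \<in> set_pmf (play A \<delta> BR1 BR2 n) \<Longrightarrow> length xs = n"
  by (induction n arbitrary: xs) (auto simp: play_Suc simp del: play.simps(2))

lemma finite_set_play: "finite (set_pmf (play A \<delta> BR1 BR2 n))"
proof (rule finite_subset)
  show "set_pmf (play A \<delta> BR1 BR2 n) \<subseteq> {xs. set xs \<subseteq> UNIV \<and> length xs = n}"
    using length_play by auto
qed (rule finite_lists_length_eq, simp)

text \<open>The tower rule, by induction on the number of rounds: given the prefix
  \<open>take t xs\<close>, the outcome \<open>xs ! t\<close> has law
  \<open>outcome_pmf (A (take t xs))\<close>.\<close>

lemma expectation_play_outcomes:
  fixes h :: "('d \<times> 'd) list \<Rightarrow> 'd \<times> 'd \<Rightarrow> 'c::{banach, second_countable_topology}"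
  shows "measure_pmf.expectation (play A \<delta> BR1 BR2 n) (\<lambda>xs. \<Sum>t<n. h (take t xs) (xs ! t)) =
    measure_pmf.expectation (play A \<delta> BR1 BR2 n)
      (\<lambda>xs. \<Sum>t<n. measure_pmf.expectation (outcome_pmf (A (take t xs))) (h (take t xs)))"
proof (induction n)
  case (Suc n)
  let ?E = "\<lambda>xs. measure_pmf.expectation (outcome_pmf (A xs)) (h xs)"
  have int: "integrable (measure_pmf (play A \<delta> BR1 BR2 n)) f" for f :: "_ \<Rightarrow> 'c"
    by (rule integrable_measure_pmf_finite [OF finite_set_play])
  have int': "integrable (measure_pmf (outcome_pmf p)) f" for p and f :: "_ \<Rightarrow> 'c"
    by (rule integrable_measure_pmf_finite) simp
  have step: "measure_pmf.expectation (play A \<delta> BR1 BR2 (Suc n)) f =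
      measure_pmf.expectation (play A \<delta> BR1 BR2 n)
        (\<lambda>xs. measure_pmf.expectation (outcome_pmf (A xs)) (\<lambda>X. f (xs @ [X])))" for f :: "_ \<Rightarrow> 'c"
    unfolding play_Suc by (subst expectation_bind_pmf_finite) (simp_all add: finite_set_play)
  \<comment> \<open>Appending an outcome alters neither the earlier prefixes nor the earlier
    outcomes.\<close>
  have prefix: "(\<Sum>t<Suc n. f (take t (xs @ [X])) ((xs @ [X]) ! t)) = (\<Sum>t<n. f (take t xs) (xs ! t)) + f xs X"
    if "xs \<in> set_pmf (play A \<delta> BR1 BR2 n)" for f :: "('d \<times> 'd) list \<Rightarrow> 'd \<times> 'd \<Rightarrow> 'c" and xs X
  proof -
    have "(\<Sum>t<n. f (take t (xs @ [X])) ((xs @ [X]) ! t)) = (\<Sum>t<n. f (take t xs) (xs ! t))"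
      using length_play [OF that] by (intro sum.cong) (auto simp: nth_append)
    then show ?thesis using length_play [OF that] by (simp add: nth_append)
  qed
  have cong: "measure_pmf.expectation (play A \<delta> BR1 BR2 n) f = measure_pmf.expectation (play A \<delta> BR1 BR2 n) g"
    if "\<And>xs. xs \<in> set_pmf (play A \<delta> BR1 BR2 n) \<Longrightarrow> f xs = g xs" for f g :: "_ \<Rightarrow> 'c"
    using that by (intro integral_cong_AE) (simp_all add: AE_measure_pmf_iff)
  \<comment> \<open>Given the first \<open>n\<close> outcomes the earlier terms are constants, and
    the last term averages to \<open>?E xs\<close>.\<close>
  have "measure_pmf.expectation (play A \<delta> BR1 BR2 (Suc n)) (\<lambda>xs. \<Sum>t<Suc n. h (take t xs) (xs ! t)) =
      measure_pmf.expectation (play A \<delta> BR1 BR2 n) (\<lambda>xs. (\<Sum>t<n. h (take t xs) (xs ! t)) + ?E xs)"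
    unfolding step by (rule cong) (simp only: prefix, simp add: Bochner_Integration.integral_add [OF int' int'])
  also have "\<dots> = measure_pmf.expectation (play A \<delta> BR1 BR2 n) (\<lambda>xs. (\<Sum>t<n. ?E (take t xs)) + ?E xs)"
    by (simp only: Bochner_Integration.integral_add [OF int int] Suc.IH)
  \<comment> \<open>These summands ignore the newest outcome, so averaging over it changes nothing
    and \<open>step\<close> can be run backwards.\<close>
  also have "\<dots> = measure_pmf.expectation (play A \<delta> BR1 BR2 (Suc n)) (\<lambda>xs. \<Sum>t<Suc n. ?E (take t xs))"
    unfolding step by (rule cong) (simp only: prefix [of _ "\<lambda>xs _. ?E xs"], simp)
  finally show ?case .
qed simp

text \<open>The self-map of the simplex of joint distributions whose approximate fixed points yield
  equilibria.\<close>

definition br_product :: "real ^ ('d \<times> 'd) \<Rightarrow> real ^ ('d \<times> 'd)" where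
  "br_product p = product_vec (fst (smooth_br_pair \<delta> BR1 BR2 p)) (snd (smooth_br_pair \<delta> BR1 BR2 p))"

text \<open>The law of the vertex that the procedure samples, before its smoothed best responses are
  returned.\<close>

definition vertex_pmf :: "(real ^ ('d \<times> 'd)) set set \<Rightarrow> nat \<Rightarrow> (real ^ ('d \<times> 'd)) pmf" where
  "vertex_pmf \<T> T = do {
     xs \<leftarrow> play A \<delta> BR1 BR2 T;
     t \<leftarrow> pmf_of_set {..<T};
     embed_pmf (\<lambda>p. test_fun \<T> p (A (take t xs)))
   }"

lemma nash_via_calibration_eq_map:
  "nash_via_calibration A \<T> T \<delta> BR1 BR2 = map_pmf (smooth_br_pair \<delta> BR1 BR2) (vertex_pmf \<T> T)"
  by (simp add: nash_via_calibration_def vertex_pmf_def map_pmf_def bind_assoc_pmf)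

section \<open>Expected fixed-point error of the sampled vertex\<close>

context
  fixes u1 u2 :: "real ^ 'd \<Rightarrow> real ^ 'd \<Rightarrow> real"
  assumes BR1: "best_response u1 BR1" and BR2: "best_response u2 BR2" and \<delta>: "0 < \<delta>"
begin

lemma br_product_eq:
  "br_product p = product_vec (smooth_br \<delta> BR1 (marginal2 p)) (smooth_br \<delta> BR2 (marginal1 p))"
  by (simp add: br_product_def smooth_br_pair_def)

text \<open>Each player's smoothed best response contributes \<open>1 / \<delta>\<close>, since
  marginals contract the l1 distance.\<close>

lemma br_product_lipschitz: "l1_norm (br_product p - br_product q) \<le> 2 / \<delta> * l1_norm (p - q)"
proof -
  have "l1_norm (br_product p - br_product q) \<le>
      l1_norm (smooth_br \<delta> BR1 (marginal2 p) - smooth_br \<delta> BR1 (marginal2 q)) +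
      l1_norm (smooth_br \<delta> BR2 (marginal1 p) - smooth_br \<delta> BR2 (marginal1 q))"
    unfolding br_product_eq
    by (intro l1_norm_product_vec_diff smooth_br_in_prob_simplex [OF BR1 \<delta>] smooth_br_in_prob_simplex [OF BR2 \<delta>])
  also have "\<dots> \<le> l1_norm (marginal2 p - marginal2 q) / \<delta> + l1_norm (marginal1 p - marginal1 q) / \<delta>"
    by (intro add_mono smooth_br_lipschitz [OF BR1 \<delta>] smooth_br_lipschitz [OF BR2 \<delta>])
  also have "\<dots> \<le> l1_norm (p - q) / \<delta> + l1_norm (p - q) / \<delta>"
    using \<delta> by (intro add_mono divide_right_mono l1_norm_marginal1 l1_norm_marginal2) auto
  finally show ?thesis by simp
qed

lemma expectation_axis_outcome_pmf:
  "measure_pmf.expectation (outcome_pmf p) (\<lambda>X. axis X 1) = br_product p"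
  unfolding outcome_pmf_def br_product_def smooth_br_pair_def fst_conv snd_conv
  by (intro expectation_axis_simplex_pmf smooth_br_in_prob_simplex [OF BR1 \<delta>] smooth_br_in_prob_simplex [OF BR2 \<delta>])

context
  fixes \<T> :: "(real ^ ('d \<times> 'd)) set set" and \<epsilon> C :: real and T :: nat
  assumes A: "forecaster A" and precision: "at_precision \<epsilon> \<T>" and T: "0 < T"
    and calibrated: "\<And>xs. length xs = T \<Longrightarrow> calibration_rate xs A \<T> \<le> C"
begin

private lemma triangulates: "triangulates_simplex \<T>"
  using precision by (simp add: at_precision_def)

private lemma A_in_prob_simplex: "A xs \<in> prob_simplex"
  using A by (simp add: forecaster_def)

text \<open>This identifies the normalised expected total weight of \<open>v\<close>, which appears
  in the calibration sum, with the probability of sampling \<open>v\<close>.\<close>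

lemma pmf_vertex_pmf:
  "pmf (vertex_pmf \<T> T) v =
    measure_pmf.expectation (play A \<delta> BR1 BR2 T) (\<lambda>xs. \<Sum>t<T. test_fun \<T> v (A (take t xs))) / T"
proof -
  have "{..<T} \<noteq> {}" using T by auto
  then show ?thesis
    unfolding vertex_pmf_def
    by (simp add: pmf_bind integral_pmf_of_set pmf_test_fun [OF triangulates A_in_prob_simplex])
qed

lemma set_vertex_pmf: "set_pmf (vertex_pmf \<T> T) \<subseteq> vertices \<T>"
proof
  fix v assume "v \<in> set_pmf (vertex_pmf \<T> T)"
  then obtain xs where "v \<in> set_pmf (embed_pmf (\<lambda>p. test_fun \<T> p (A xs)))"
    by (auto simp: vertex_pmf_def)
  then have "test_fun \<T> v (A xs) \<noteq> 0"
    by (simp add: set_pmf_iff pmf_test_fun [OF triangulates A_in_prob_simplex])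
  then show "v \<in> vertices \<T>"
    using test_fun_eq_0 [OF triangulates A_in_prob_simplex]
      corners_subset_vertices [OF triangulates A_in_prob_simplex] by blast
qed

text \<open>
  The norm stands outside the expectation, so the sampled outcomes may be replaced by their
  conditional means exactly: no concentration inequality enters.
\<close>

lemma expected_fixed_point_error_le:
  "measure_pmf.expectation (vertex_pmf \<T> T) (\<lambda>v. l1_norm (v - br_product v)) \<le> C + \<epsilon> + 2 / \<delta> * \<epsilon>"
proof -
  let ?P = "play A \<delta> BR1 BR2 T"
  let ?E = "measure_pmf.expectation ?P"
  let ?p = "\<lambda>xs t. A (take t xs)"
  let ?w = "\<lambda>v xs t. test_fun \<T> v (?p xs t)"
  let ?c = "\<epsilon> + 2 / \<delta> * \<epsilon>"
  have int: "integrable (measure_pmf ?P) f" for f :: "_ \<Rightarrow> 'c::{banach, second_countable_topology}"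
    by (rule integrable_measure_pmf_finite [OF finite_set_play])
  note w_nonneg = test_fun_nonneg [OF triangulates A_in_prob_simplex]
  \<comment> \<open>The weight and the forecast of round \<open>t\<close> are fixed by the past, so
    the tower rule replaces the outcome by its mean.\<close>
  have replace: "?E (\<lambda>xs. \<Sum>t<T. ?w v xs t *\<^sub>R (?p xs t - axis (xs ! t) 1)) =
      ?E (\<lambda>xs. \<Sum>t<T. ?w v xs t *\<^sub>R (?p xs t - br_product (?p xs t)))" for v
  proof -
    have "measure_pmf.expectation (outcome_pmf q) (\<lambda>X. q - axis X 1) = q - br_product q" for q
    proof -
      have "integrable (measure_pmf (outcome_pmf q)) f" for f :: "_ \<Rightarrow> real ^ ('d \<times> 'd)"
        by (rule integrable_measure_pmf_finite) simp
      then show ?thesis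
        by (simp add: Bochner_Integration.integral_diff expectation_axis_outcome_pmf)
    qed
    then show ?thesis
      using expectation_play_outcomes [of T "\<lambda>ys X. test_fun \<T> v (A ys) *\<^sub>R (A ys - axis X 1)"] by simp
  qed
  \<comment> \<open>The cost of moving from a forecast to the vertex: \<open>\<epsilon>\<close> for
    the point and \<open>2 / \<delta> * \<epsilon>\<close> for its image. Rounds in which
    \<open>v\<close> is not a corner have weight 0.\<close>
  have smooth: "l1_norm (\<Sum>t<T. ?w v xs t *\<^sub>R ((v - ?p xs t) - (br_product v - br_product (?p xs t))))
      \<le> (\<Sum>t<T. ?w v xs t) * ?c" for v xs
  proof -
    have "?w v xs t * l1_norm ((v - ?p xs t) - (br_product v - br_product (?p xs t))) \<le> ?w v xs t * ?c" for t
    proof (cases "v \<in> corners \<T> (?p xs t)")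
      case True
      have close: "l1_norm (v - ?p xs t) \<le> \<epsilon>"
        using precision A_in_prob_simplex True by (rule l1_norm_corner_le)
      have "l1_norm ((v - ?p xs t) - (br_product v - br_product (?p xs t))) \<le>
          l1_norm (v - ?p xs t) + l1_norm (br_product (?p xs t) - br_product v)"
        using l1_norm_triangle [of "v - ?p xs t" "br_product (?p xs t) - br_product v"]
        by (simp add: algebra_simps)
      also have "\<dots> \<le> l1_norm (v - ?p xs t) + 2 / \<delta> * l1_norm (v - ?p xs t)"
        using br_product_lipschitz [of "?p xs t" v] by (simp add: l1_norm_minus_commute)
      also have "\<dots> \<le> ?c"
        using close \<delta> by (intro add_mono mult_left_mono) auto
      finally show ?thesis by (intro mult_left_mono w_nonneg)
    qed (simp add: test_fun_eq_0 [OF triangulates A_in_prob_simplex])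
    then show ?thesis
      unfolding sum_distrib_right
      by (intro order_trans [OF l1_norm_sum] sum_mono) (simp add: w_nonneg)
  qed
  have vertex: "pmf (vertex_pmf \<T> T) v * l1_norm (v - br_product v) \<le>
      ?E (\<lambda>xs. l1_norm (\<Sum>t<T. ?w v xs t *\<^sub>R (?p xs t - axis (xs ! t) 1))) / T + pmf (vertex_pmf \<T> T) v * ?c" for v
  proof -
    have W_nonneg: "0 \<le> ?E (\<lambda>xs. \<Sum>t<T. ?w v xs t)"
      by (intro Bochner_Integration.integral_nonneg sum_nonneg w_nonneg)
    have "?E (\<lambda>xs. \<Sum>t<T. ?w v xs t) * l1_norm (v - br_product v) =
        l1_norm (?E (\<lambda>xs. \<Sum>t<T. ?w v xs t) *\<^sub>R (v - br_product v))"
      using W_nonneg by simp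
    also have "?E (\<lambda>xs. \<Sum>t<T. ?w v xs t) *\<^sub>R (v - br_product v) =
        ?E (\<lambda>xs. (\<Sum>t<T. ?w v xs t) *\<^sub>R (v - br_product v))"
      by (rule integral_scaleR_left [symmetric]) (rule int)
    \<comment> \<open>Writing f for \<open>br_product\<close> and p for the forecast, v - f v = (p -
      f p) + ((v - p) - (f v - f p)).\<close>
    also have "\<dots> = ?E (\<lambda>xs. (\<Sum>t<T. ?w v xs t *\<^sub>R (?p xs t - br_product (?p xs t))) +
        (\<Sum>t<T. ?w v xs t *\<^sub>R ((v - ?p xs t) - (br_product v - br_product (?p xs t)))))"
      by (simp add: scaleR_sum_left flip: sum.distrib scaleR_add_right)
    also have "\<dots> = ?E (\<lambda>xs. \<Sum>t<T. ?w v xs t *\<^sub>R (?p xs t - axis (xs ! t) 1)) +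
        ?E (\<lambda>xs. \<Sum>t<T. ?w v xs t *\<^sub>R ((v - ?p xs t) - (br_product v - br_product (?p xs t))))"
      unfolding replace by (rule Bochner_Integration.integral_add) (rule int)+
    also have "l1_norm \<dots> \<le> ?E (\<lambda>xs. l1_norm (\<Sum>t<T. ?w v xs t *\<^sub>R (?p xs t - axis (xs ! t) 1))) +
        ?E (\<lambda>xs. l1_norm (\<Sum>t<T. ?w v xs t *\<^sub>R ((v - ?p xs t) - (br_product v - br_product (?p xs t)))))"
      by (intro order_trans [OF l1_norm_triangle] add_mono l1_norm_expectation_le finite_set_play)
    also have "\<dots> \<le> ?E (\<lambda>xs. l1_norm (\<Sum>t<T. ?w v xs t *\<^sub>R (?p xs t - axis (xs ! t) 1))) +
        ?E (\<lambda>xs. (\<Sum>t<T. ?w v xs t) * ?c)"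
      by (intro add_left_mono integral_mono int smooth)
    also have "?E (\<lambda>xs. (\<Sum>t<T. ?w v xs t) * ?c) = ?E (\<lambda>xs. \<Sum>t<T. ?w v xs t) * ?c"
      by (rule Bochner_Integration.integral_mult_left) (rule int)
    finally show ?thesis
      unfolding pmf_vertex_pmf using T by (simp add: field_simps)
  qed
  have "measure_pmf.expectation (vertex_pmf \<T> T) (\<lambda>v. l1_norm (v - br_product v)) =
      (\<Sum>v\<in>vertices \<T>. pmf (vertex_pmf \<T> T) v * l1_norm (v - br_product v))"
    using set_vertex_pmf by (subst integral_measure_pmf [OF finite_vertices [OF triangulates]]) auto
  also have "\<dots> \<le> (\<Sum>v\<in>vertices \<T>.
      ?E (\<lambda>xs. l1_norm (\<Sum>t<T. ?w v xs t *\<^sub>R (?p xs t - axis (xs ! t) 1))) / T + pmf (vertex_pmf \<T> T) v * ?c)"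
    by (intro sum_mono vertex)
  also have "\<dots> = ?E (\<lambda>xs. 1 / T * (\<Sum>v\<in>vertices \<T>. l1_norm (\<Sum>t<T. ?w v xs t *\<^sub>R (?p xs t - axis (xs ! t) 1)))) +
      (\<Sum>v\<in>vertices \<T>. pmf (vertex_pmf \<T> T) v) * ?c"
    by (simp add: sum.distrib sum_distrib_right Bochner_Integration.integral_sum int flip: sum_divide_distrib)
  \<comment> \<open>The integrand is the calibration rate of the play, at most \<open>C\<close> for
    every outcome sequence of length \<open>T\<close>.\<close>
  also have "?E (\<lambda>xs. 1 / T * (\<Sum>v\<in>vertices \<T>. l1_norm (\<Sum>t<T. ?w v xs t *\<^sub>R (?p xs t - axis (xs ! t) 1)))) \<le> C"
  proof (rule measure_pmf.integral_le_const [OF int])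
    show "AE xs in measure_pmf ?P.
        1 / T * (\<Sum>v\<in>vertices \<T>. l1_norm (\<Sum>t<T. ?w v xs t *\<^sub>R (?p xs t - axis (xs ! t) 1))) \<le> C"
      unfolding AE_measure_pmf_iff using calibrated by (auto dest!: length_play simp: calibration_rate_def)
  qed
  also have "(\<Sum>v\<in>vertices \<T>. pmf (vertex_pmf \<T> T) v) = 1"
    using finite_vertices [OF triangulates] set_vertex_pmf by (rule sum_pmf_eq_1)
  finally show ?thesis by simp
qed

end

end

end

section \<open>From approximate fixed points to approximate equilibria\<close>

text \<open>The returned strategies are near-best responses to the marginals of \<open>p\<close>.
  They are also the marginals of \<open>br_product\<close> at \<open>p\<close>, so replacing the
  marginals of \<open>p\<close> by them changes any deviation gain by at most the fixed-point
  error.\<close>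

lemma nash_of_fixed_point_error:
  fixes U1 U2 :: "real ^ 'd ^ 'd"
  assumes U1: "\<And>i j. 0 \<le> U1 $ i $ j \<and> U1 $ i $ j \<le> 1"
    and U2: "\<And>i j. 0 \<le> U2 $ i $ j \<and> U2 $ i $ j \<le> 1"
    and BR1: "best_response (\<lambda>x q. payoff U1 x q) BR1"
    and BR2: "best_response (\<lambda>y q. payoff U2 q y) BR2"
    and \<delta>: "0 < \<delta>" and p: "p \<in> prob_simplex"
    and \<eta>: "l1_norm (p - br_product \<delta> BR1 BR2 p) + real CARD('d) * \<delta> \<le> \<eta>"
  shows "case smooth_br_pair \<delta> BR1 BR2 p of (x, y) \<Rightarrow> approx_nash \<eta> U1 U2 x y"
proof -
  define x y where "x = smooth_br \<delta> BR1 (marginal2 p)" and "y = smooth_br \<delta> BR2 (marginal1 p)"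
  have BR2': "best_response (payoff (transpose U2)) BR2"
    using BR2 by (simp add: payoff_transpose [abs_def])
  have U2': "0 \<le> transpose U2 $ i $ j \<and> transpose U2 $ i $ j \<le> 1" for i j
    using U2 by (simp add: transpose_def)
  have x: "x \<in> prob_simplex" and y: "y \<in> prob_simplex"
    unfolding x_def y_def
    by (rule smooth_br_in_prob_simplex [OF BR1 \<delta>], rule smooth_br_in_prob_simplex [OF BR2 \<delta>])
  have f: "br_product \<delta> BR1 BR2 p = product_vec x y"
    by (simp add: br_product_def smooth_br_pair_def x_def y_def)
  \<comment> \<open>\<open>x\<close> is the first marginal of \<open>br_product\<close> at
    \<open>p\<close>, and taking marginals contracts.\<close>
  have dx: "l1_norm (x - marginal1 p) \<le> l1_norm (p - br_product \<delta> BR1 BR2 p)"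
    using l1_norm_marginal1 [of "product_vec x y" p] y by (simp add: f marginal1_product_vec l1_norm_minus_commute)
  have dy: "l1_norm (y - marginal2 p) \<le> l1_norm (p - br_product \<delta> BR1 BR2 p)"
    using l1_norm_marginal2 [of "product_vec x y" p] x by (simp add: f marginal2_product_vec l1_norm_minus_commute)
  have "payoff U1 x y \<ge> payoff U1 x' y - \<eta>" if x': "x' \<in> prob_simplex" for x'
  proof -
    have "payoff U1 x' (marginal2 p) - real CARD('d) * \<delta> \<le> payoff U1 x (marginal2 p)"
      unfolding x_def using U1 BR1 \<delta> marginal2_in_prob_simplex [OF p] x' by (rule smooth_br_approx_best_response)
    then show ?thesis
      using payoff_gain_lipschitz [OF U1 x x', of y "marginal2 p"] dy \<eta> by linarith
  qed
  moreover have "payoff U2 x y \<ge> payoff U2 x y' - \<eta>" if y': "y' \<in> prob_simplex" for y'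
  proof -
    have "payoff (transpose U2) y' (marginal1 p) - real CARD('d) * \<delta> \<le> payoff (transpose U2) y (marginal1 p)"
      unfolding y_def using U2' BR2' \<delta> marginal1_in_prob_simplex [OF p] y' by (rule smooth_br_approx_best_response)
    then show ?thesis
      using payoff_gain_lipschitz [OF U2' y y', of x "marginal1 p"] dx \<eta> unfolding payoff_transpose by linarith
  qed
  ultimately show ?thesis
    using x y by (simp add: approx_nash_def smooth_br_pair_def x_def y_def)
qed

theorem theorem3:
  fixes A :: "(real ^ ('d::finite \<times> 'd)) set set \<Rightarrow> ('d \<times> 'd) list \<Rightarrow> real ^ ('d \<times> 'd)"
    and F :: "nat \<Rightarrow> (real ^ ('d \<times> 'd)) set set \<Rightarrow> nat \<Rightarrow> real"
    and U1 U2 :: "real ^ 'd ^ 'd"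
    and BR1 BR2 :: "real ^ 'd \<Rightarrow> real ^ 'd"
    and \<epsilon> :: real
    and \<T> :: "(real ^ ('d \<times> 'd)) set set"
    and T :: nat
  assumes forecaster:
      "\<And>e \<S>. 0 < e \<Longrightarrow> at_precision e \<S> \<Longrightarrow> forecaster (A \<S>)"
    and calibrated:
      "\<And>e \<S> xs. 0 < e \<Longrightarrow> at_precision e \<S> \<Longrightarrow> xs \<noteq> [] \<Longrightarrow>
         calibration_rate xs (A \<S>) \<S> \<le> F (CARD('d)\<^sup>2) \<S> (length xs)"
    and d: "CARD('d) > 2"
    and eps: "0 < \<epsilon>" "\<epsilon> < 1 / real (CARD('d)) ^ 3"
    and U1: "\<And>i j. 0 \<le> U1 $ i $ j \<and> U1 $ i $ j \<le> 1"
    and U2: "\<And>i j. 0 \<le> U2 $ i $ j \<and> U2 $ i $ j \<le> 1"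
    and BR1: "best_response (\<lambda>x q. payoff U1 x q) BR1"
    and BR2: "best_response (\<lambda>y q. payoff U2 q y) BR2"
    and precision: "at_precision \<epsilon> \<T>"
    and T: "T \<ge> 1"
  shows "measure_pmf.prob (nash_via_calibration (A \<T>) \<T> T (root 3 \<epsilon>) BR1 BR2)
           {(x, y). approx_nash (4 * F (CARD('d)\<^sup>2) \<T> T + 22 * real (CARD('d)) * root 3 \<epsilon>) U1 U2 x y}
         > 1 / 2"
proof -
  define \<delta> where "\<delta> = root 3 \<epsilon>"
  define C where "C = F (CARD('d)\<^sup>2) \<T> T"
  \<comment> \<open>The Markov threshold. It has 21 where the claim has 22: the remaining
    \<open>d * \<delta>\<close> is the smoothing loss added by
    \<open>nash_of_fixed_point_error\<close>.\<close>
  define c where "c = 4 * C + 21 * real CARD('d) * \<delta>"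
  let ?R = "vertex_pmf (A \<T>) \<delta> BR1 BR2 \<T> T"
  let ?Z = "\<lambda>v. l1_norm (v - br_product \<delta> BR1 BR2 v)"
  have \<delta>: "0 < \<delta>" and \<delta>3: "\<delta> ^ 3 = \<epsilon>"
    using eps(1) by (simp_all add: \<delta>_def)
  have "\<epsilon> < 1"
  proof -
    have "1 / real CARD('d) ^ 3 \<le> 1" using d by (simp add: field_simps)
    then show ?thesis using eps(2) by linarith
  qed
  then have \<delta>1: "\<delta> < 1"
    by (simp add: \<delta>_def)
  \<comment> \<open>The calibration hypothesis concerns nonempty sequences; \<open>T \<ge> 1\<close>
    excludes the empty one.\<close>
  have calib: "calibration_rate xs (A \<T>) \<T> \<le> C" if "length xs = T" for xs
    using calibrated [OF eps(1) precision, of xs] that T by (cases "xs = []") (auto simp: C_def)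
  \<comment> \<open>\<open>C\<close> bounds a nonnegative rate; any outcome sequence of length
    \<open>T\<close> serves as witness.\<close>
  have C: "0 \<le> C"
  proof -
    have "0 \<le> calibration_rate (replicate T undefined) (A \<T>) \<T>"
      by (simp add: calibration_rate_def sum_nonneg)
    also have "\<dots> \<le> C" by (rule calib) simp
    finally show ?thesis .
  qed
  \<comment> \<open>With \<open>\<epsilon> = \<delta> ^ 3\<close> and \<open>\<delta> < 1\<close>,
    the error terms \<open>\<delta> ^ 3\<close> and \<open>2 * \<delta> ^ 2\<close> total at most
    \<open>3 * \<delta>\<close>, and \<open>\<delta>\<close> is at most
    \<open>d * \<delta>\<close>.\<close>
  have c: "0 < c" "2 * (C + \<epsilon> + 2 / \<delta> * \<epsilon>) < c"
  proof -
    have \<epsilon>: "2 / \<delta> * \<epsilon> = 2 * (\<delta> * \<delta>)" "\<epsilon> = \<delta> * \<delta> * \<delta>"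
      using \<delta> by (simp_all add: \<delta>3 [symmetric] power3_eq_cube)
    define D where "D = real CARD('d) * \<delta>"
    have sq: "\<delta> * \<delta> \<le> \<delta>"
      using mult_right_mono [of \<delta> 1 \<delta>] \<delta> \<delta>1 by simp
    have cube: "\<delta> * \<delta> * \<delta> \<le> \<delta>"
      using mult_right_mono [OF sq, of \<delta>] sq \<delta> by linarith
    have D: "\<delta> \<le> D"
      using mult_right_mono [of 1 "real CARD('d)" \<delta>] \<delta> d by (simp add: D_def)
    have c_eq: "c = 4 * C + 21 * D"
      by (simp add: c_def D_def)
    show "0 < c"
      unfolding c_eq using C \<delta> D by linarith
    have "\<epsilon> + 2 / \<delta> * \<epsilon> \<le> 3 * \<delta>"
      using sq cube \<epsilon> by linarith
    then have "C + \<epsilon> + 2 / \<delta> * \<epsilon> \<le> C + 3 * \<delta>"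
      by linarith
    also have "\<dots> < c / 2"
      unfolding c_eq using C \<delta> D by simp
    finally show "2 * (C + \<epsilon> + 2 / \<delta> * \<epsilon>) < c"
      by (simp only: less_divide_eq_numeral1 mult.commute)
  qed
  have T': "0 < T" using T by simp
  note fore = forecaster [OF eps(1) precision]
  have tri: "triangulates_simplex \<T>"
    using precision by (simp add: at_precision_def)
  have supp: "set_pmf ?R \<subseteq> vertices \<T>"
    using set_vertex_pmf [OF BR1 BR2 \<delta> fore precision T' calib] .
  \<comment> \<open>Markov's inequality; the finite support of \<open>?R\<close> supplies
    integrability.\<close>
  have "measure_pmf.prob ?R {v. c \<le> ?Z v} \<le> measure_pmf.expectation ?R ?Z / c"
    using integral_Markov_inequality_measure [of "measure_pmf ?R" ?Z UNIV c] c(1)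
      finite_subset [OF supp finite_vertices [OF tri]]
    by (simp add: integrable_measure_pmf_finite)
  also have "\<dots> \<le> (C + \<epsilon> + 2 / \<delta> * \<epsilon>) / c"
    using c(1) expected_fixed_point_error_le [OF BR1 BR2 \<delta> fore precision T' calib]
    by (intro divide_right_mono) auto
  also have "\<dots> < 1 / 2"
    using c by (simp add: field_simps)
  finally have "1 / 2 < measure_pmf.prob ?R (- {v. c \<le> ?Z v})"
    using measure_pmf.prob_compl [of "{v. c \<le> ?Z v}" ?R] by (simp add: Compl_eq_Diff_UNIV)
  \<comment> \<open>On the support every point is a vertex, hence in the simplex, as the passage to
    equilibria requires.\<close>
  also have "\<dots> = measure_pmf.prob ?R (- {v. c \<le> ?Z v} \<inter> set_pmf ?R)"
    by (simp add: measure_Int_set_pmf)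
  also have "\<dots> \<le> measure_pmf.prob ?R (smooth_br_pair \<delta> BR1 BR2 -` {(x, y). approx_nash (c + real CARD('d) * \<delta>) U1 U2 x y})"
  proof (rule measure_pmf.finite_measure_mono)
    show "- {v. c \<le> ?Z v} \<inter> set_pmf ?R \<subseteq>
        smooth_br_pair \<delta> BR1 BR2 -` {(x, y). approx_nash (c + real CARD('d) * \<delta>) U1 U2 x y}"
    proof
      fix v assume v: "v \<in> - {v. c \<le> ?Z v} \<inter> set_pmf ?R"
      then have "v \<in> prob_simplex"
        using supp vertices_subset_prob_simplex [OF tri] by blast
      moreover have "?Z v + real CARD('d) * \<delta> \<le> c + real CARD('d) * \<delta>"
        using v by auto
      ultimately have "case smooth_br_pair \<delta> BR1 BR2 v of (x, y) \<Rightarrow> approx_nash (c + real CARD('d) * \<delta>) U1 U2 x y"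
        by (rule nash_of_fixed_point_error [OF U1 U2 BR1 BR2 \<delta>])
      then show "v \<in> smooth_br_pair \<delta> BR1 BR2 -` {(x, y). approx_nash (c + real CARD('d) * \<delta>) U1 U2 x y}"
        by (simp add: case_prod_beta)
    qed
  qed simp
  also have "\<dots> = measure_pmf.prob (nash_via_calibration (A \<T>) \<T> T \<delta> BR1 BR2)
      {(x, y). approx_nash (c + real CARD('d) * \<delta>) U1 U2 x y}"
    by (simp add: nash_via_calibration_eq_map measure_map_pmf)
  also have "c + real CARD('d) * \<delta> = 4 * F (CARD('d)\<^sup>2) \<T> T + 22 * real (CARD('d)) * root 3 \<epsilon>"
    by (simp add: c_def C_def \<delta>_def)
  finally show ?thesis
    unfolding \<delta>_def .
qed

end
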